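(* Let $k$ be a fixed natural number, and let $\Sigma\subseteq\Lambda^{(2)}$ be the equivalence relation defined as follows: for $n\in\mathbb{N}$ and $s,t\in B_n^{(2)}$, $$(s,t)\in\Sigma\iff |\mathrm{left}^i(s)|=|\mathrm{left}^i(t)|\ \text{ for } i=1,\ldots,k.$$ Then $\Sigma$ is closed under the implication operator, thus $\Sigma=\sigma(\mathbf{A})$ is the fine spectrum of some binary groupoid $\mathbf{A}$. The corresponding associative spectrum is a polynomial of degree $k$ in $n$: for all $n\ge1$, $$s_n(\mathbf{A})=\binom{n-1}{k}+\binom{n-1}{k-1}+\cdots+\binom{n-1}{1}+\binom{n-1}{0}.$$
   Context: $\mathbb{N}$ includes $0$. $T$ is the set of binary bracketings: terms (prefix notation) over the single variable $x$ and the binary operation symbol $\omega$, i.e. $x\in T$, and $\omega t_1t_2\in T$ whenever $t_1,t_2\in T$. $|t|_\omega$ is the number of occurrences of $\omega$ and $|t|=|t|_\omega+1$ the number of occurrences of $x$ in $t$. $B_n^{(2)}=\{t\in T:|t|_\omega=n\}$, $\Lambda^{(2)}=\{(s,t)\in T\times T:|s|_\omega=|t|_\omega\}$, and $\Sigma_n=\Sigma\cap(B_n^{(2)}\times B_n^{(2)})$. The left factor is $\mathrm{left}(\omega t_1t_2)=t_1$, $\mathrm{left}(x)=x$; $\mathrm{left}^i$ is its $i$-fold iterate. $\gamma_1(t)=\omega tx$, $\gamma_2(t)=\omega xt$; $\beta_i(t)$ is obtained from $t$ by replacing the $i$-th occurrence (from the left) of $x$ in $t$ by $\omega xx$. For an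 equivalence relation $\pi$ on $B_n^{(2)}$, $\delta_n(\pi)$ is the equivalence relation on $B_{n+1}^{(2)}$ that is the transitive closure of $\bigcup_\xi\{(\xi(s),\xi(t)):(s,t)\in\pi\}$, where $\xi$ ranges over $\gamma_1,\gamma_2,\beta_1,\ldots,\beta_{n+1}$. "$\Sigma$ is closed under the implication operator" means $\delta_n(\Sigma_n)\subseteq\Sigma_{n+1}$ for all $n\in\mathbb{N}$. A binary groupoid is a set with one binary operation. $\varepsilon_1(t)$ is the term obtained from $t$ by replacing the occurrences of $x$, from left to right, by distinct variables $x_1,x_2,\ldots$. The fine spectrum $\sigma(\mathbf{A})$ is the set of all $(s,t)\in\Lambda^{(2)}$ such that $\mathbf{A}$ satisfies the identity $\varepsilon_1(s)\approx\varepsilon_1(t)$; $\sigma_n(\mathbf{A})$ is its restriction to $B_n^{(2)}$; the associative spectrum is $s_n(\mathbf{A})=|B_n^{(2)}/\sigma_n(\mathbf{A})|$. *)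

theory Defs
  imports "HOL-Computational_Algebra.Polynomial"
begin

datatype 'v trm = Var 'v | Omega "'v trm" "'v trm"

text \<open>Binary bracketings are the terms over a single variable.\<close>

type_synonym bracketing = "unit trm"

abbreviation X :: bracketing where
  "X \<equiv> Var ()"

fun omegas :: "'v trm \<Rightarrow> nat" where
  "omegas (Var v) = 0"
| "omegas (Omega t1 t2) = omegas t1 + omegas t2 + 1"

definition len :: "'v trm \<Rightarrow> nat" where
  "len t = omegas t + 1"

definition B :: "nat \<Rightarrow> bracketing set" where
  "B n = {t. omegas t = n}"

definition Lambda :: "bracketing rel" where
  "Lambda = {(s, t). omegas s = omegas t}"

definition level :: "bracketing rel \<Rightarrow> nat \<Rightarrow> bracketing rel" where
  "level S n = S \<inter> (B n \<times> B n)"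

fun left :: "'v trm \<Rightarrow> 'v trm" where
  "left (Var v) = Var v"
| "left (Omega t1 t2) = t1"

definition gamma1 :: "bracketing \<Rightarrow> bracketing" where
  "gamma1 t = Omega t X"

definition gamma2 :: "bracketing \<Rightarrow> bracketing" where
  "gamma2 t = Omega X t"

text \<open>The positions \<open>i\<close> are counted from 1; \<open>beta i t\<close> is meaningful
  for \<open>1 \<le> i \<le> len t\<close> only.\<close>

fun beta :: "nat \<Rightarrow> bracketing \<Rightarrow> bracketing" where
  "beta i (Var v) = (if i = 1 then Omega X X else Var v)"
| "beta i (Omega t1 t2) =
     (if i \<le> len t1 then Omega (beta i t1) t2 else Omega t1 (beta (i - len t1) t2))"

definition delta :: "nat \<Rightarrow> bracketing rel \<Rightarrow> bracketing rel" where
  "delta n \<pi> = (\<Union>\<xi> \<in> {gamma1, gamma2} \<union> beta ` {1..n + 1}. {(\<xi> s, \<xi> t) |s t. (s, t) \<in> \<pi>})\<^sup>+"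

definition implication_closed :: "bracketing rel \<Rightarrow> bool" where
  "implication_closed S \<longleftrightarrow> (\<forall>n. delta n (level S n) \<subseteq> level S (n + 1))"

definition groupoid :: "'a set \<Rightarrow> ('a \<Rightarrow> 'a \<Rightarrow> 'a) \<Rightarrow> bool" where
  "groupoid A f \<longleftrightarrow> A \<noteq> {} \<and> (\<forall>a\<in>A. \<forall>b\<in>A. f a b \<in> A)"

fun eval :: "('a \<Rightarrow> 'a \<Rightarrow> 'a) \<Rightarrow> ('v \<Rightarrow> 'a) \<Rightarrow> 'v trm \<Rightarrow> 'a" where
  "eval f h (Var v) = h v"
| "eval f h (Omega t1 t2) = f (eval f h t1) (eval f h t2)"

definition satisfies :: "'a set \<Rightarrow> ('a \<Rightarrow> 'a \<Rightarrow> 'a) \<Rightarrow> 'v trm \<Rightarrow> 'v trm \<Rightarrow> bool" where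
  "satisfies A f s t \<longleftrightarrow> (\<forall>h. range h \<subseteq> A \<longrightarrow> eval f h s = eval f h t)"

text \<open>The variable \<open>x\<^sub>i\<close> is \<open>Var i\<close>; \<open>number_from m\<close> uses the variables
  \<open>x\<^sub>m, x\<^bsub>m+1\<^esub>, \<dots>\<close> from left to right.\<close>

fun number_from :: "nat \<Rightarrow> bracketing \<Rightarrow> nat trm" where
  "number_from m (Var v) = Var m"
| "number_from m (Omega t1 t2) = Omega (number_from m t1) (number_from (m + len t1) t2)"

definition eps1 :: "bracketing \<Rightarrow> nat trm" where
  "eps1 t = number_from 1 t"

definition fine_spectrum :: "'a set \<Rightarrow> ('a \<Rightarrow> 'a \<Rightarrow> 'a) \<Rightarrow> bracketing rel" where
  "fine_spectrum A f = {(s, t) \<in> Lambda. satisfies A f (eps1 s) (eps1 t)}"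

definition assoc_spectrum :: "'a set \<Rightarrow> ('a \<Rightarrow> 'a \<Rightarrow> 'a) \<Rightarrow> nat \<Rightarrow> nat" where
  "assoc_spectrum A f n = card (B n // level (fine_spectrum A f) n)"

definition left_equiv :: "nat \<Rightarrow> bracketing rel" where
  "left_equiv k =
     {(s, t) \<in> Lambda. \<forall>i\<in>{1..k}. len ((left ^^ i) s) = len ((left ^^ i) t)}"

end

theory Submission
  imports Defs "HOL-Library.Nat_Bijection"
begin

text \<open>The relation is the kernel of the map sending \<open>t\<close> to the sequence
  \<open>|t|, |left t|, \<dots>, |left\<^sup>k t|\<close>. The required groupoid consists of sequences of numbers with
  the product \<open>(a\<^sub>0, \<dots>, a\<^sub>k) (b\<^sub>0, \<dots>, b\<^sub>k) = (a\<^sub>0 + b\<^sub>0, a\<^sub>0, \<dots>, a\<^bsub>k-1\<^esub>)\<close>: evaluating \<open>t\<close> at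
  \<open>(1, \<dots>, 1)\<close> yields the sequence of \<open>t\<close>, and, conversely, under any assignment of values to
  the leaves, the value of \<open>t\<close> depends only on its sequence and on that assignment. Splitting off
  the first entry of the sequence shows that the number of sequences for \<open>k + 1\<close> and \<open>n\<close> is the
  sum of those for \<open>k\<close> and \<open>m < n\<close>, whence the binomial sum.\<close>

section \<open>Lengths of the iterated left factors\<close>

primrec profile :: "nat \<Rightarrow> 'v trm \<Rightarrow> nat list" where
  "profile 0 t = [len t]"
| "profile (Suc k) t = len t # profile k (left t)"

lemma len_Var [simp]: "len (Var v) = 1"
  by (simp add: len_def)

lemma len_Omega [simp]: "len (Omega s t) = len s + len t"
  by (simp add: len_def)

lemma len_eq_iff: "len s = len t \<longleftrightarrow> omegas s = omegas t"
  by (simp add: len_def)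

lemma hd_profile [simp]: "hd (profile k t) = len t"
  by (cases k) auto

lemma len_eq_if_profile_eq: "profile k s = profile k t \<Longrightarrow> len s = len t"
  by (metis hd_profile)

lemma take_profile: "j \<le> k \<Longrightarrow> take (Suc j) (profile k t) = profile j t"
proof (induction j arbitrary: k t)
  case 0
  then show ?case by (cases k) auto
next
  case (Suc j)
  then show ?case by (cases k) auto
qed

lemma profile_Var: "profile k (Var v) = replicate (Suc k) 1"
  by (induction k) auto

lemma profile_eq_iff:
  "profile k s = profile k t \<longleftrightarrow> (\<forall>i\<le>k. len ((left ^^ i) s) = len ((left ^^ i) t))"
proof (induction k arbitrary: s t)
  case 0
  then show ?case by simp
next
  case (Suc k)
  have "(\<forall>i\<le>Suc k. P i) \<longleftrightarrow> P 0 \<and> (\<forall>i\<le>k. P (Suc i))" for P :: "nat \<Rightarrow> bool"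
    by (metis Suc_le_mono le0 not0_implies_Suc)
  then show ?case
    using Suc by (simp del: funpow.simps add: funpow_Suc_right)
qed

text \<open>The index 0, which is missing from the range of \<open>i\<close> in
  \<open>left_equiv\<close>, is supplied by \<open>Lambda\<close>.\<close>

lemma left_equiv_iff: "(s, t) \<in> left_equiv k \<longleftrightarrow> profile k s = profile k t"
proof -
  have "(\<forall>i\<le>k. P i) \<longleftrightarrow> P 0 \<and> (\<forall>i\<in>{1..k}. P i)" for P :: "nat \<Rightarrow> bool"
    by (metis Suc_le_eq One_nat_def atLeastAtMost_iff bot_nat_0.not_eq_extremum le0)
  from this[of "\<lambda>i. len ((left ^^ i) s) = len ((left ^^ i) t)"] show ?thesis
    by (simp add: left_equiv_def Lambda_def profile_eq_iff len_eq_iff)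
qed

lemma equiv_left_equiv: "equiv UNIV (left_equiv k)"
  by (intro equivI refl_onI symI transI) (auto simp: left_equiv_iff)

lemma trm_pair_cases:
  fixes s t :: bracketing
  assumes "len s = len t"
  obtains "s = X" "t = X"
  | s1 s2 t1 t2 where "s = Omega s1 s2" "t = Omega t1 t2"
  using assms by (cases s; cases t) (auto simp: len_def)

section \<open>Closure under the implication operator\<close>

lemma len_beta: "1 \<le> i \<Longrightarrow> i \<le> len t \<Longrightarrow> len (beta i t) = Suc (len t)"
  by (induction i t rule: beta.induct) auto

text \<open>The left factor of \<open>gamma1 t\<close> is \<open>t\<close>, so the entries after the
  first form a prefix of \<open>profile k t\<close>.\<close>

lemma profile_gamma1_cong:
  "profile k s = profile k t \<Longrightarrow> profile k (gamma1 s) = profile k (gamma1 t)"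
proof (cases k)
  case (Suc j)
  moreover assume "profile k s = profile k t"
  moreover from this have "profile j s = profile j t"
    using Suc by (metis take_profile le_SucI order_refl)
  ultimately show ?thesis
    by (auto simp: gamma1_def)
qed (auto simp: gamma1_def)

lemma profile_gamma2_cong:
  "profile k s = profile k t \<Longrightarrow> profile k (gamma2 s) = profile k (gamma2 t)"
  by (frule len_eq_if_profile_eq, cases k) (auto simp: gamma2_def)

text \<open>As the left factors have equal lengths, leaf number \<open>i\<close> lies on the same
  side in both terms. On the left the induction hypothesis applies; on the right only the first
  entry changes.\<close>

lemma profile_beta_cong:
  assumes "profile k s = profile k t" "1 \<le> i" "i \<le> len s"
  shows "profile k (beta i s) = profile k (beta i t)"
  using assms
proof (induction k arbitrary: s t)
  case 0
  then show ?case by (simp add: len_beta)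
next
  case (Suc k)
  have len: "len s = len t"
    using Suc.prems(1) by simp
  then show ?case
  proof (cases rule: trm_pair_cases)
    case 1
    then show ?thesis by simp
  next
    case (2 s1 s2 t1 t2)
    then have left: "profile k s1 = profile k t1"
      using Suc.prems(1) by simp
    then have "len s1 = len t1"
      by (rule len_eq_if_profile_eq)
    moreover have "len (beta i s) = len (beta i t)"
      using Suc.prems len by (simp add: len_beta)
    ultimately show ?thesis
      using 2 left Suc.IH[OF left] Suc.prems(2) by (auto simp: len_beta)
  qed
qed

lemma implication_closed_left_equiv: "implication_closed (left_equiv k)"
  unfolding implication_closed_def
proof
  fix n
  let ?R = "\<Union>\<xi> \<in> {gamma1, gamma2} \<union> beta ` {1..n + 1}. {(\<xi> s, \<xi> t) |s t. (s, t) \<in> level (left_equiv k) n}"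
  have "(\<xi> s, \<xi> t) \<in> level (left_equiv k) (n + 1)"
    if \<xi>: "\<xi> \<in> {gamma1, gamma2} \<union> beta ` {1..n + 1}" and st: "(s, t) \<in> level (left_equiv k) n"
    for \<xi> s t
  proof -
    have eq: "profile k s = profile k t" and om: "omegas s = n" "omegas t = n"
      using st by (auto simp: level_def left_equiv_iff B_def)
    have "profile k (\<xi> s) = profile k (\<xi> t)"
      using \<xi> om profile_gamma1_cong[OF eq] profile_gamma2_cong[OF eq] profile_beta_cong[OF eq]
      by (auto simp: len_def)
    moreover have "omegas (\<xi> u) = n + 1" if "omegas u = n" for u
      using \<xi> that len_beta[of _ u] by (auto simp: gamma1_def gamma2_def len_def)
    ultimately show ?thesis
      using om by (simp add: level_def left_equiv_iff B_def)
  qed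
  then have "?R \<subseteq> level (left_equiv k) (n + 1)"
    by blast
  then have "?R\<^sup>+ \<subseteq> (level (left_equiv k) (n + 1))\<^sup>+"
    by (rule trancl_mono_subset)
  \<comment> \<open>The target is transitive, so checking the generating pairs was enough.\<close>
  also have "\<dots> = level (left_equiv k) (n + 1)"
    by (rule trancl_id) (auto simp: level_def left_equiv_iff intro!: transI)
  finally show "delta n (level (left_equiv k) n) \<subseteq> level (left_equiv k) (n + 1)"
    unfolding delta_def .
qed

section \<open>The groupoid of number sequences\<close>

definition shift_add :: "nat \<Rightarrow> nat list \<Rightarrow> nat list \<Rightarrow> nat list" where
  "shift_add k xs ys = (hd xs + hd ys) # take k xs"

lemma hd_shift_add [simp]: "hd (shift_add k xs ys) = hd xs + hd ys"
  by (simp add: shift_add_def)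

lemma take_shift_add [simp]:
  "take (Suc j) (shift_add k xs ys) = (hd xs + hd ys) # take (min j k) xs"
  by (simp add: shift_add_def)

text \<open>Heads add at each product, and the leaves carry consecutive variables. Empty lists do no
  harm, since \<open>hd []\<close> is some fixed number.\<close>

lemma hd_eval_shift_add:
  "hd (eval (shift_add k) h (number_from m t)) = (\<Sum>i = m..<m + len t. hd (h i))"
proof (induction t arbitrary: m)
  case (Omega t1 t2)
  then show ?case
    by (simp add: sum.atLeastLessThan_concat add.assoc)
qed simp

text \<open>For products, the first entry is fixed by the length; the others come from the value of
  the left factor, whose variables also start at \<open>m\<close>.\<close>

lemma take_eval_shift_add_cong:
  assumes "profile j s = profile j t" "j \<le> k"
  shows "take (Suc j) (eval (shift_add k) h (number_from m s)) =
         take (Suc j) (eval (shift_add k) h (number_from m t))"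
  using assms
proof (induction j arbitrary: s t)
  case 0
  then have len: "len s = len t" by simp
  \<comment> \<open>Single leaves are set apart: an assigned list may be empty, so its head does not
    determine its prefix.\<close>
  then show ?case
  proof (cases rule: trm_pair_cases)
    case 1
    then show ?thesis by simp
  next
    case 2
    then show ?thesis
      using hd_eval_shift_add[of k h m s] hd_eval_shift_add[of k h m t] len
      by simp
  qed
next
  case (Suc j)
  then have len: "len s = len t" by simp
  then show ?case
  proof (cases rule: trm_pair_cases)
    case 1
    then show ?thesis by simp
  next
    case (2 s1 s2 t1 t2)
    then have "take (Suc j) (eval (shift_add k) h (number_from m s1)) =
               take (Suc j) (eval (shift_add k) h (number_from m t1))"
      using Suc.prems by (intro Suc.IH) simp_all
    then show ?thesis
      using 2 hd_eval_shift_add[of k h m s] hd_eval_shift_add[of k h m t] len Suc.prems(2)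
      by (simp add: min_def)
  qed
qed

text \<open>The value of a product has at most \<open>k + 1\<close> entries, so it equals its prefix
  of that length.\<close>

lemma eval_shift_add_cong:
  assumes "profile k s = profile k t"
  shows "eval (shift_add k) h (number_from m s) = eval (shift_add k) h (number_from m t)"
  using len_eq_if_profile_eq[OF assms]
proof (cases rule: trm_pair_cases)
  case 1
  then show ?thesis by simp
next
  case 2
  then show ?thesis
    using take_eval_shift_add_cong[OF assms order_refl, of h m] by (simp add: shift_add_def)
qed

text \<open>A variable is fixed by \<open>left\<close>, so its profile is all ones; the profile of a
  product is the total length followed by the first \<open>k\<close> entries of the profile of its
  left factor.\<close>

lemma eval_shift_add_ones:
  "eval (shift_add k) (\<lambda>_. replicate (Suc k) 1) (number_from m t) = profile k t"
proof (induction t arbitrary: m)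
  case (Var v)
  then show ?case by (simp add: profile_Var)
next
  case (Omega t1 t2)
  have "take k (profile k t1) = tl (profile k (Omega t1 t2))"
    using take_profile[of "k - 1" k t1] by (cases k) (simp_all del: take_Suc_Cons)
  with Omega show ?case
    by (cases k) (simp_all add: shift_add_def)
qed

text \<open>At every inner product \<open>d\<close> undoes \<open>e\<close>. This moves the groupoid
  of lists to the natural numbers.\<close>

lemma eval_conjugate:
  assumes "\<And>x. d (e x) = x"
  shows "d (eval (\<lambda>a b. e (f (d a) (d b))) h t) = eval f (d \<circ> h) t"
  using assms by (induction t) auto

lemma left_equiv_is_fine_spectrum:
  "\<exists>(A :: nat set) f. groupoid A f \<and> left_equiv k = fine_spectrum A f"
proof (intro exI conjI)
  define f where "f a b = list_encode (shift_add k (list_decode a) (list_decode b))" for a b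
  show "groupoid UNIV f"
    by (simp add: groupoid_def)
  have eval_f: "list_decode (eval f h t) = eval (shift_add k) (list_decode \<circ> h) t"
    for h and t :: "nat trm"
    using eval_conjugate[of list_decode list_encode "shift_add k" h t] by (simp add: f_def[abs_def])
  have "satisfies UNIV f (eps1 s) (eps1 t) \<longleftrightarrow> profile k s = profile k t" for s t
  proof
    assume "satisfies UNIV f (eps1 s) (eps1 t)"
    then have "eval f (\<lambda>_. list_encode (replicate (Suc k) 1)) (number_from 1 s) =
        eval f (\<lambda>_. list_encode (replicate (Suc k) 1)) (number_from 1 t)"
      unfolding satisfies_def eps1_def by blast
    from arg_cong[OF this, of list_decode] show "profile k s = profile k t"
      by (simp only: eval_f comp_def list_encode_inverse eval_shift_add_ones)
  next
    assume "profile k s = profile k t"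
    \<comment> \<open>Decoding is injective, so equality of the decoded values suffices.\<close>
    then show "satisfies UNIV f (eps1 s) (eps1 t)"
      by (metis eval_f eval_shift_add_cong eps1_def list_decode_inverse satisfies_def)
  qed
  then show "left_equiv k = fine_spectrum UNIV f"
    by (auto simp: fine_spectrum_def left_equiv_iff Lambda_def
        dest: len_eq_if_profile_eq[unfolded len_eq_iff])
qed

section \<open>Counting the profiles\<close>

lemma B_0: "B 0 = {X}"
proof -
  have "omegas t = 0 \<longleftrightarrow> t = X" for t :: bracketing
    by (cases t) auto
  then show ?thesis by (auto simp: B_def)
qed

lemma B_nonempty: "B n \<noteq> {}"
proof -
  have "omegas ((gamma1 ^^ n) X) = n"
    by (induction n) (auto simp: gamma1_def)
  then show ?thesis by (auto simp: B_def)
qed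

lemma profile_image_0: "profile 0 ` B n = {[Suc n]}"
  using B_nonempty[of n] by (auto simp: B_def len_def)

text \<open>The two factors share the \<open>n\<close> operations below the root: the left one may
  take any number \<open>m\<close> of them, and some right factor takes the rest.\<close>

lemma profile_image_Suc:
  "profile (Suc k) ` B (Suc n) = (\<Union>m\<le>n. (#) (n + 2) ` profile k ` B m)"
proof (intro equalityI subsetI)
  fix v assume "v \<in> profile (Suc k) ` B (Suc n)"
  then obtain t :: bracketing where t: "omegas t = Suc n" "v = profile (Suc k) t"
    by (auto simp: B_def simp del: profile.simps)
  then obtain t1 t2 where "t = Omega t1 t2"
    by (cases t) auto
  with t show "v \<in> (\<Union>m\<le>n. (#) (n + 2) ` profile k ` B m)"
    by (intro UN_I[of "omegas t1"]) (auto simp: B_def len_def)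
next
  fix v assume "v \<in> (\<Union>m\<le>n. (#) (n + 2) ` profile k ` B m)"
  then obtain t1 :: bracketing where t1: "omegas t1 \<le> n" "v = (n + 2) # profile k t1"
    by (auto simp: B_def)
  obtain t2 :: bracketing where "omegas t2 = n - omegas t1"
    using B_nonempty[of "n - omegas t1"] by (auto simp: B_def)
  with t1 show "v \<in> profile (Suc k) ` B (Suc n)"
    by (intro image_eqI[of _ _ "Omega t1 t2"]) (auto simp: B_def len_def)
qed

lemma finite_profile_image: "finite (profile k ` B n)"
proof (induction k arbitrary: n)
  case 0
  then show ?case by (simp only: profile_image_0) simp
next
  case (Suc k)
  then show ?case
    by (cases n) (simp add: B_0, simp only: profile_image_Suc, blast)
qed

text \<open>The pieces for different \<open>m\<close> are disjoint, since the second entry of the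
  profile is \<open>m + 1\<close>.\<close>

lemma card_profile_image_Suc:
  "card (profile (Suc k) ` B (Suc n)) = (\<Sum>m\<le>n. card (profile k ` B m))"
proof -
  have "(#) (n + 2) ` profile k ` B i \<inter> (#) (n + 2) ` profile k ` B j = {}" if "i \<noteq> j" for i j
    using that by (auto simp: B_def len_eq_iff dest!: len_eq_if_profile_eq)
  then have "card (profile (Suc k) ` B (Suc n)) = (\<Sum>m\<le>n. card ((#) (n + 2) ` profile k ` B m))"
    unfolding profile_image_Suc by (intro card_UN_disjoint) (auto intro: finite_profile_image)
  then show ?thesis
    by (simp add: card_image)
qed

lemma card_profile_image: "card (profile k ` B (Suc n)) = (\<Sum>i=0..k. n choose i)"
proof (induction k arbitrary: n)
  case 0
  then show ?case by (simp only: profile_image_0) simp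
next
  case (Suc k)
  have hockey_stick: "(\<Sum>m<n. m choose i) = n choose Suc i" for i
    by (induction n) auto
  \<comment> \<open>The case \<open>m = 0\<close> is split off because the induction hypothesis
    covers only \<open>Suc m\<close>; it contributes the summand \<open>n choose 0\<close>.\<close>
  have "card (profile (Suc k) ` B (Suc n)) =
      card (profile k ` B 0) + (\<Sum>m<n. card (profile k ` B (Suc m)))"
    by (simp only: card_profile_image_Suc sum.atMost_shift)
  also have "\<dots> = 1 + (\<Sum>i=0..k. n choose Suc i)"
    by (simp add: Suc B_0 sum.swap[of _ "{0..k}"] hockey_stick)
  also have "\<dots> = (\<Sum>i=0..Suc k. n choose i)"
    by (simp only: sum.atLeast0_atMost_Suc_shift) simp
  finally show ?case .
qed

text \<open>The classes are the nonempty fibers of \<open>profile k\<close> on \<open>B n\<close>,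
  one for each value attained.\<close>

lemma card_quotient_left_equiv:
  "card (B n // level (left_equiv k) n) = card (profile k ` B n)"
proof -
  let ?fiber = "\<lambda>v. {t \<in> B n. profile k t = v}"
  have "level (left_equiv k) n `` {s} = ?fiber (profile k s)" if "s \<in> B n" for s
    using that by (auto simp: level_def left_equiv_iff)
  then have "B n // level (left_equiv k) n = ?fiber ` profile k ` B n"
    by (auto simp: quotient_def)
  moreover have "inj_on ?fiber (profile k ` B n)"
    by (rule inj_onI) blast
  ultimately show ?thesis
    by (simp add: card_image)
qed

section \<open>The binomial sum as a polynomial\<close>

lemma degree_linear_prod: "degree (\<Prod>j<i. [:c j, 1:] :: 'a::idom poly) = i"
  by (subst degree_prod_eq_sum_degree) auto

text \<open>All earlier summands have smaller degree than the last, so its leading term cannot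
  cancel.\<close>

lemma degree_sum_strict:
  assumes "\<And>i. degree (q i) = i"
  shows "degree (\<Sum>i=0..k. q i) = k"
proof (induction k)
  case (Suc k)
  then show ?case
    using assms by (simp add: degree_add_eq_right)
qed (simp add: assms)

lemma sum_binomial_is_poly:
  "\<exists>p :: real poly. degree p = k \<and>
     (\<forall>n\<ge>1. real (\<Sum>i=0..k. (n - 1) choose i) = poly p (real n))"
proof (intro exI conjI allI impI)
  \<comment> \<open>The roots are 1, ..., \<open>i\<close>, because \<open>(n - 1) choose i\<close>
    is the product of \<open>n - 1\<close>, ..., \<open>n - i\<close> divided by
    \<open>fact i\<close>.\<close>
  define q :: "nat \<Rightarrow> real poly"
    where "q i = smult (1 / fact i) (\<Prod>j<i. [:- 1 - real j, 1:])" for i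
  show "degree (\<Sum>i=0..k. q i) = k"
    by (rule degree_sum_strict) (simp add: q_def degree_linear_prod)
  fix n :: nat assume "n \<ge> 1"
  then have "real ((n - 1) choose i) = poly (q i) (real n)" for i
    by (simp add: q_def binomial_gbinomial gbinomial_prod_rev poly_prod lessThan_atLeast0
        of_nat_diff algebra_simps)
  then show "real (\<Sum>i=0..k. (n - 1) choose i) = poly (\<Sum>i=0..k. q i) (real n)"
    by (simp add: poly_sum)
qed

theorem mainTheorem6:
  fixes k :: nat
  shows "equiv UNIV (left_equiv k)
    \<and> implication_closed (left_equiv k)
    \<and> (\<exists>(A :: nat set) f. groupoid A f \<and> left_equiv k = fine_spectrum A f)
    \<and> (\<forall>(A :: 'a set) f. groupoid A f \<and> left_equiv k = fine_spectrum A f \<longrightarrow>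
          (\<forall>n\<ge>1. assoc_spectrum A f n = (\<Sum>i=0..k. (n - 1) choose i))
        \<and> (\<exists>p :: real poly. degree p = k \<and>
             (\<forall>n\<ge>1. real (assoc_spectrum A f n) = poly p (real n))))"
proof (intro conjI allI impI equiv_left_equiv implication_closed_left_equiv
    left_equiv_is_fine_spectrum)
  fix A :: "'a set" and f
  assume A: "groupoid A f \<and> left_equiv k = fine_spectrum A f"
  \<comment> \<open>The associative spectrum depends only on the fine spectrum, so the count of
    profiles applies to every groupoid realizing the relation.\<close>
  show spectrum: "assoc_spectrum A f n = (\<Sum>i=0..k. (n - 1) choose i)" if "n \<ge> 1" for n
    using A that card_profile_image[of k "n - 1"] card_quotient_left_equiv[of n k]
    by (simp add: assoc_spectrum_def)
  then show "\<exists>p :: real poly. degree p = k \<and>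
      (\<forall>n\<ge>1. real (assoc_spectrum A f n) = poly p (real n))"
    using sum_binomial_is_poly[of k] by simp
qed

end
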